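(* Let $R$ be a (von Neumann) regular ring, not necessarily unital. Then one can define mutually inverse lattice isomorphisms $\varphi\colon\mathrm{NId}\,\mathbb{L}(R)\to\mathrm{Id}\,R$ and $\psi\colon\mathrm{Id}\,R\to\mathrm{NId}\,\mathbb{L}(R)$ by the rules $$\varphi(\mathbf{I}):=\{x\in R\mid xR\in\mathbf{I}\}\quad\text{for each }\mathbf{I}\in\mathrm{NId}\,\mathbb{L}(R),$$ $$\psi(I):=\{X\in\mathbb{L}(R)\mid X\subseteq I\}\quad\text{for each }I\in\mathrm{Id}\,R.$$
   Context: Rings are associative but not necessarily unital. A ring $R$ is (von Neumann) regular if for each $a\in R$ there is $b\in R$ with $a=aba$. For a regular ring $R$, $\mathbb{L}(R)=\{xR\mid x\in R\}$ is the set of principal right ideals, ordered by inclusion; it is a sectionally complemented modular lattice, a sublattice of the lattice of all right ideals of $R$. $\mathrm{Id}\,R$ is the lattice of all two-sided ideals of $R$. An ideal of a lattice $L$ with zero is a nonempty lower subset closed under binary joins. An ideal $I$ of $L$ is *neutral* if for all ideals $X,Y$ of $L$ the sublattice of the ideal lattice of $L$ generated by $\{I,X,Y\}$ is distributive. $\mathrm{NId}\,L$ is the lattice of all neutral ideals of $L$, ordered by inclusion. *)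

theory Defs
  imports Main "HOL-Algebra.Lattice"
begin

text \<open>
  The type class \<open>ring\<close> is the class of associative rings, with no unit required (unital rings form
  the class \<open>ring_1\<close>). A ring \<open>R\<close> is therefore rendered as a type \<open>'a::ring\<close>. Lattices are
  \<open>HOL-Algebra\<close> order records, since their elements are sets singled out by a predicate.
\<close>

definition inclusion_order :: "'a set set \<Rightarrow> 'a set gorder"
  where "inclusion_order A = \<lparr>carrier = A, eq = (=), le = (\<subseteq>)\<rparr>"

definition principal_right_ideal :: "'a::ring \<Rightarrow> 'a set"
  where "principal_right_ideal x = {x * y |y. True}"

definition principal_right_ideals :: "'a::ring set gorder"
  where "principal_right_ideals = inclusion_order (range principal_right_ideal)"

definition two_sided_ideal :: "'a::ring set \<Rightarrow> bool"
  where "two_sided_ideal I \<longleftrightarrow>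
    0 \<in> I \<and> (\<forall>x\<in>I. \<forall>y\<in>I. x + y \<in> I) \<and> (\<forall>x\<in>I. - x \<in> I) \<and>
    (\<forall>x\<in>I. \<forall>r. r * x \<in> I \<and> x * r \<in> I)"

definition two_sided_ideals :: "'a::ring set gorder"
  where "two_sided_ideals = inclusion_order {I. two_sided_ideal I}"

definition lattice_ideal :: "'a gorder \<Rightarrow> 'a set \<Rightarrow> bool"
  where "lattice_ideal L I \<longleftrightarrow>
    I \<subseteq> carrier L \<and> I \<noteq> {} \<and>
    (\<forall>x\<in>I. \<forall>y\<in>carrier L. y \<sqsubseteq>\<^bsub>L\<^esub> x \<longrightarrow> y \<in> I) \<and>
    (\<forall>x\<in>I. \<forall>y\<in>I. x \<squnion>\<^bsub>L\<^esub> y \<in> I)"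

definition lattice_ideals :: "'a gorder \<Rightarrow> 'a set gorder"
  where "lattice_ideals L = inclusion_order {I. lattice_ideal L I}"

definition sublattice :: "'a gorder \<Rightarrow> 'a set \<Rightarrow> bool"
  where "sublattice L S \<longleftrightarrow>
    S \<subseteq> carrier L \<and> (\<forall>x\<in>S. \<forall>y\<in>S. x \<sqinter>\<^bsub>L\<^esub> y \<in> S \<and> x \<squnion>\<^bsub>L\<^esub> y \<in> S)"

definition generated_sublattice :: "'a gorder \<Rightarrow> 'a set \<Rightarrow> 'a set"
  where "generated_sublattice L G = \<Inter>{S. sublattice L S \<and> G \<subseteq> S}"

text \<open>Meaningful for a sublattice \<open>S\<close> of \<open>L\<close>, whose operations are those of \<open>L\<close>.\<close>

definition distributive_on :: "'a gorder \<Rightarrow> 'a set \<Rightarrow> bool"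
  where "distributive_on L S \<longleftrightarrow>
    (\<forall>x\<in>S. \<forall>y\<in>S. \<forall>z\<in>S. x \<sqinter>\<^bsub>L\<^esub> (y \<squnion>\<^bsub>L\<^esub> z) = (x \<sqinter>\<^bsub>L\<^esub> y) \<squnion>\<^bsub>L\<^esub> (x \<sqinter>\<^bsub>L\<^esub> z))"

definition neutral_ideal :: "'a gorder \<Rightarrow> 'a set \<Rightarrow> bool"
  where "neutral_ideal L I \<longleftrightarrow>
    lattice_ideal L I \<and>
    (\<forall>X Y. lattice_ideal L X \<longrightarrow> lattice_ideal L Y \<longrightarrow>
      distributive_on (lattice_ideals L) (generated_sublattice (lattice_ideals L) {I, X, Y}))"

definition neutral_ideals :: "'a gorder \<Rightarrow> 'a set gorder"
  where "neutral_ideals L = inclusion_order {I. neutral_ideal L I}"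

definition lattice_isomorphism :: "'a gorder \<Rightarrow> 'b gorder \<Rightarrow> ('a \<Rightarrow> 'b) \<Rightarrow> bool"
  where "lattice_isomorphism L M f \<longleftrightarrow>
    lattice L \<and> lattice M \<and> bij_betw f (carrier L) (carrier M) \<and>
    (\<forall>x\<in>carrier L. \<forall>y\<in>carrier L.
      f (x \<sqinter>\<^bsub>L\<^esub> y) = f x \<sqinter>\<^bsub>M\<^esub> f y \<and> f (x \<squnion>\<^bsub>L\<^esub> y) = f x \<squnion>\<^bsub>M\<^esub> f y)"

definition ring_ideal_of :: "'a::ring set set \<Rightarrow> 'a set"
  where "ring_ideal_of \<I> = {x. principal_right_ideal x \<in> \<I>}"

definition neutral_ideal_of :: "'a::ring set \<Rightarrow> 'a set set"
  where "neutral_ideal_of I = {X \<in> carrier principal_right_ideals. X \<subseteq> I}"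

end

theory Submission
  imports Defs "HOL-Library.Set_Algebras"
begin

text \<open>
  For a regular ring, the ideals of \<open>\<bbbL>(R)\<close> correspond to the right ideals of \<open>R\<close>, so the claim is that
  a right ideal \<open>I\<close> is neutral among right ideals iff it is two-sided.

  If \<open>I\<close> is two-sided, then \<open>Z \<mapsto> Z \<inter> I\<close> and \<open>Z \<mapsto> Z + I\<close> are lattice homomorphisms which jointly
  determine \<open>Z\<close>; both send the sublattice generated by \<open>I, X, Y\<close> into a sublattice generated by two
  elements and a common bound of them, and such a lattice is distributive.

  Conversely, let \<open>I\<close> be neutral, \<open>e \<in> I\<close> idempotent and \<open>y = re - ere\<close>, so that \<open>eR \<inter> yR = 0\<close>.
  Since \<open>e \<in> (e + y)R + yR\<close>, neutrality gives \<open>e = u + v\<close> with \<open>u \<in> I \<inter> (e + y)R\<close> and \<open>v \<in> yR\<close>,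
  which forces \<open>u = e + y\<close>, hence \<open>y \<in> I\<close> and \<open>re \<in> I\<close>.
\<close>

subsection \<open>Lattices of sets\<close>

lemma inclusion_order_simps [simp]:
  "carrier (inclusion_order C) = C"
  "le (inclusion_order C) = (\<subseteq>)"
  "eq (inclusion_order C) = (=)"
  by (simp_all add: inclusion_order_def)

lemma partial_order_inclusion_order: "partial_order (inclusion_order C)"
  by unfold_locales auto

lemma least_Upper_inclusion_order_iff:
  assumes "A \<in> C" "B \<in> C"
  shows "least (inclusion_order C) U (Upper (inclusion_order C) {A, B}) \<longleftrightarrow>
    U \<in> C \<and> A \<subseteq> U \<and> B \<subseteq> U \<and> (\<forall>V\<in>C. A \<subseteq> V \<longrightarrow> B \<subseteq> V \<longrightarrow> U \<subseteq> V)"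
proof -
  have "Upper (inclusion_order C) {A, B} = {V \<in> C. A \<subseteq> V \<and> B \<subseteq> V}"
    using assms by (auto simp only: Upper_def inclusion_order_simps)
  then show ?thesis by (simp add: least_def Ball_def imp_conjL)
qed

lemma greatest_Lower_inclusion_order_iff:
  assumes "A \<in> C" "B \<in> C"
  shows "greatest (inclusion_order C) U (Lower (inclusion_order C) {A, B}) \<longleftrightarrow>
    U \<in> C \<and> U \<subseteq> A \<and> U \<subseteq> B \<and> (\<forall>V\<in>C. V \<subseteq> A \<longrightarrow> V \<subseteq> B \<longrightarrow> V \<subseteq> U)"
proof -
  have "Lower (inclusion_order C) {A, B} = {V \<in> C. V \<subseteq> A \<and> V \<subseteq> B}"
    using assms by (auto simp only: Lower_def inclusion_order_simps)
  then show ?thesis by (simp add: greatest_def Ball_def imp_conjL)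
qed

text \<open>Since \<open>join\<close> picks its value by Hilbert choice, antisymmetry is used to
  show that \<open>U\<close> is the only candidate. The same device computes meets below.\<close>

lemma join_inclusion_order:
  assumes "A \<in> C" "B \<in> C" "U \<in> C" "A \<subseteq> U" "B \<subseteq> U"
    and "\<forall>V\<in>C. A \<subseteq> V \<longrightarrow> B \<subseteq> V \<longrightarrow> U \<subseteq> V"
  shows "A \<squnion>\<^bsub>inclusion_order C\<^esub> B = U"
proof -
  have "least (inclusion_order C) V (Upper (inclusion_order C) {A, B}) \<longleftrightarrow> V = U" for V
    unfolding least_Upper_inclusion_order_iff[OF assms(1,2)]
    using assms(3-5) by (metis assms(6) subset_antisym)
  then show ?thesis by (simp add: join_def sup_def)
qed

lemma meet_inclusion_order:
  assumes "A \<in> C" "B \<in> C" "U \<in> C" "U \<subseteq> A" "U \<subseteq> B"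
    and "\<forall>V\<in>C. V \<subseteq> A \<longrightarrow> V \<subseteq> B \<longrightarrow> V \<subseteq> U"
  shows "A \<sqinter>\<^bsub>inclusion_order C\<^esub> B = U"
proof -
  have "greatest (inclusion_order C) V (Lower (inclusion_order C) {A, B}) \<longleftrightarrow> V = U" for V
    unfolding greatest_Lower_inclusion_order_iff[OF assms(1,2)]
    using assms(3-5) by (metis assms(6) subset_antisym)
  then show ?thesis by (simp add: meet_def inf_def)
qed

lemma lattice_inclusion_orderI:
  assumes "\<And>A B. A \<in> C \<Longrightarrow> B \<in> C \<Longrightarrow>
      \<exists>U\<in>C. A \<subseteq> U \<and> B \<subseteq> U \<and> (\<forall>V\<in>C. A \<subseteq> V \<longrightarrow> B \<subseteq> V \<longrightarrow> U \<subseteq> V)"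
    and "\<And>A B. A \<in> C \<Longrightarrow> B \<in> C \<Longrightarrow>
      \<exists>U\<in>C. U \<subseteq> A \<and> U \<subseteq> B \<and> (\<forall>V\<in>C. V \<subseteq> A \<longrightarrow> V \<subseteq> B \<longrightarrow> V \<subseteq> U)"
  shows "lattice (inclusion_order C)"
proof -
  interpret partial_order "inclusion_order C" by (rule partial_order_inclusion_order)
  show ?thesis
  proof
    fix A B assume AB: "A \<in> carrier (inclusion_order C)" "B \<in> carrier (inclusion_order C)"
    then have AB': "A \<in> C" "B \<in> C" by simp_all
    show "\<exists>s. least (inclusion_order C) s (Upper (inclusion_order C) {A, B})"
      using assms(1)[OF AB'] by (simp only: least_Upper_inclusion_order_iff[OF AB'] Bex_def)
    show "\<exists>s. greatest (inclusion_order C) s (Lower (inclusion_order C) {A, B})"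
      using assms(2)[OF AB'] by (simp only: greatest_Lower_inclusion_order_iff[OF AB'] Bex_def)
  qed
qed

text \<open>Joins and meets are determined by the order, so an order isomorphism carries them along.
  That the target is a lattice is derived rather than assumed; this is how the neutral ideals will
  be seen to form one.\<close>

lemma lattice_isomorphism_inclusion_order:
  assumes lat: "lattice (inclusion_order C)"
    and bij: "bij_betw f C D"
    and mono: "\<And>A B. A \<in> C \<Longrightarrow> B \<in> C \<Longrightarrow> f A \<subseteq> f B \<longleftrightarrow> A \<subseteq> B"
  shows "lattice_isomorphism (inclusion_order C) (inclusion_order D) f"
proof -
  have D: "D = f ` C" using bij by (simp add: bij_betw_def)
  interpret lattice "inclusion_order C" by (rule lat)
  have join: "J \<in> C \<and> A \<subseteq> J \<and> B \<subseteq> J \<and> (\<forall>V\<in>C. A \<subseteq> V \<longrightarrow> B \<subseteq> V \<longrightarrow> J \<subseteq> V)"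
    if AB: "A \<in> C" "B \<in> C" and J: "J = A \<squnion>\<^bsub>inclusion_order C\<^esub> B" for A B J
  proof -
    obtain U where "least (inclusion_order C) U (Upper (inclusion_order C) {A, B})"
      using sup_of_two_exists[of A B] AB unfolding inclusion_order_simps by metis
    then have U: "U \<in> C" "A \<subseteq> U" "B \<subseteq> U" "\<forall>V\<in>C. A \<subseteq> V \<longrightarrow> B \<subseteq> V \<longrightarrow> U \<subseteq> V"
      by (simp_all add: least_Upper_inclusion_order_iff AB)
    moreover have "A \<squnion>\<^bsub>inclusion_order C\<^esub> B = U"
      by (rule join_inclusion_order) (use AB U in simp_all)
    ultimately show ?thesis by (simp add: J)
  qed
  have meet: "M \<in> C \<and> M \<subseteq> A \<and> M \<subseteq> B \<and> (\<forall>V\<in>C. V \<subseteq> A \<longrightarrow> V \<subseteq> B \<longrightarrow> V \<subseteq> M)"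
    if AB: "A \<in> C" "B \<in> C" and M: "M = A \<sqinter>\<^bsub>inclusion_order C\<^esub> B" for A B M
  proof -
    obtain U where "greatest (inclusion_order C) U (Lower (inclusion_order C) {A, B})"
      using inf_of_two_exists[of A B] AB unfolding inclusion_order_simps by metis
    then have U: "U \<in> C" "U \<subseteq> A" "U \<subseteq> B" "\<forall>V\<in>C. V \<subseteq> A \<longrightarrow> V \<subseteq> B \<longrightarrow> V \<subseteq> U"
      by (simp_all add: greatest_Lower_inclusion_order_iff AB)
    moreover have "A \<sqinter>\<^bsub>inclusion_order C\<^esub> B = U"
      by (rule meet_inclusion_order) (use AB U in simp_all)
    ultimately show ?thesis by (simp add: M)
  qed
  have latD: "lattice (inclusion_order D)"
  proof (rule lattice_inclusion_orderI)
    fix P Q assume "P \<in> D" "Q \<in> D"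
    then obtain A B where AB: "A \<in> C" "B \<in> C" and PQ: "P = f A" "Q = f B"
      unfolding D by (elim imageE)
    show "\<exists>U\<in>D. P \<subseteq> U \<and> Q \<subseteq> U \<and> (\<forall>V\<in>D. P \<subseteq> V \<longrightarrow> Q \<subseteq> V \<longrightarrow> U \<subseteq> V)"
      using join[OF AB HOL.refl] AB
      by (intro bexI[of _ "f (A \<squnion>\<^bsub>inclusion_order C\<^esub> B)"]) (simp_all add: PQ D mono)
    show "\<exists>U\<in>D. U \<subseteq> P \<and> U \<subseteq> Q \<and> (\<forall>V\<in>D. V \<subseteq> P \<longrightarrow> V \<subseteq> Q \<longrightarrow> V \<subseteq> U)"
      using meet[OF AB HOL.refl] AB
      by (intro bexI[of _ "f (A \<sqinter>\<^bsub>inclusion_order C\<^esub> B)"]) (simp_all add: PQ D mono)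
  qed
  have "f (A \<sqinter>\<^bsub>inclusion_order C\<^esub> B) = f A \<sqinter>\<^bsub>inclusion_order D\<^esub> f B"
    if AB: "A \<in> C" "B \<in> C" for A B
    by (rule meet_inclusion_order[symmetric]) (use AB meet[OF AB HOL.refl] in \<open>simp_all add: D mono\<close>)
  moreover have "f (A \<squnion>\<^bsub>inclusion_order C\<^esub> B) = f A \<squnion>\<^bsub>inclusion_order D\<^esub> f B"
    if AB: "A \<in> C" "B \<in> C" for A B
    by (rule join_inclusion_order[symmetric]) (use AB join[OF AB HOL.refl] in \<open>simp_all add: D mono\<close>)
  ultimately show ?thesis
    using lat latD bij by (simp add: lattice_isomorphism_def)
qed

subsection \<open>Right ideals of a regular ring\<close>

definition regular_ring :: "'a::ring itself \<Rightarrow> bool"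
  where "regular_ring _ \<longleftrightarrow> (\<forall>a::'a. \<exists>b. a = a * b * a)"

text \<open>The bracketing exhibits \<open>b * a\<close> as a right unit of \<open>a\<close> lying
  in every left ideal that contains \<open>a\<close>. This is the substitute for a unit of the ring
  in most arguments below.\<close>

lemma regular_ringE:
  assumes "regular_ring TYPE('a::ring)"
  obtains b where "(a::'a) * (b * a) = a"
  using assms unfolding regular_ring_def by (metis mult.assoc)

text \<open>Closure under negation is left out: it is automatic over a regular ring.\<close>

definition right_ideal :: "'a::ring set \<Rightarrow> bool"
  where "right_ideal J \<longleftrightarrow> 0 \<in> J \<and> (\<forall>x\<in>J. \<forall>y\<in>J. x + y \<in> J) \<and> (\<forall>x\<in>J. \<forall>r. x * r \<in> J)"

lemma right_idealD:
  assumes "right_ideal J"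
  shows "0 \<in> J" "x \<in> J \<Longrightarrow> y \<in> J \<Longrightarrow> x + y \<in> J" "x \<in> J \<Longrightarrow> x * r \<in> J"
  using assms by (auto simp: right_ideal_def)

text \<open>Negation of \<open>x\<close> is a right multiplication, by the negative of the right
  unit \<open>b * x\<close>.\<close>

lemma right_ideal_uminus:
  assumes "regular_ring TYPE('a::ring)" "right_ideal J" "(x::'a) \<in> J"
  shows "- x \<in> J"
proof -
  obtain b where "x * (b * x) = x" using assms(1) by (rule regular_ringE)
  then have "- x = x * (- (b * x))" by simp
  then show ?thesis using right_idealD(3)[OF assms(2,3)] by metis
qed

lemma right_ideal_diff:
  assumes "regular_ring TYPE('a::ring)" "right_ideal J" "(x::'a) \<in> J" "y \<in> J"
  shows "x - y \<in> J"
  using right_idealD(2)[OF assms(2,3) right_ideal_uminus[OF assms(1,2,4)]] by simp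

lemma right_ideal_Int: "right_ideal A \<Longrightarrow> right_ideal B \<Longrightarrow> right_ideal (A \<inter> B)"
  by (auto simp: right_ideal_def)

lemma right_ideal_set_plus:
  assumes A: "right_ideal A" and B: "right_ideal B"
  shows "right_ideal (A + B)"
  unfolding right_ideal_def
proof (intro conjI ballI allI)
  show "0 \<in> A + B" using set_plus_intro[of 0 A 0 B] assms by (simp add: right_idealD)
  fix x assume "x \<in> A + B"
  then obtain a b where x: "x = a + b" "a \<in> A" "b \<in> B" by (rule set_plus_elim)
  show "x * r \<in> A + B" for r
    unfolding x(1) distrib_right
    by (intro set_plus_intro right_idealD(3)[OF A] right_idealD(3)[OF B] x)
  fix y assume "y \<in> A + B"
  then obtain c d where y: "y = c + d" "c \<in> A" "d \<in> B" by (rule set_plus_elim)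
  have "(a + c) + (b + d) \<in> A + B"
    by (intro set_plus_intro right_idealD(2)[OF A] right_idealD(2)[OF B] x y)
  then show "x + y \<in> A + B" by (simp add: x y algebra_simps)
qed

lemma subset_set_plus:
  assumes "right_ideal A" "right_ideal B"
  shows "A \<subseteq> A + B" "B \<subseteq> A + B"
  using set_zero_plus2[of A B] set_zero_plus2[of B A] assms
  by (simp_all add: right_idealD add.commute)

lemma set_plus_subset:
  assumes "right_ideal C" "A \<subseteq> C" "B \<subseteq> C"
  shows "A + B \<subseteq> C"
proof
  fix x assume "x \<in> A + B"
  then obtain a b where "x = a + b" "a \<in> A" "b \<in> B" by (rule set_plus_elim)
  then show "x \<in> C" using right_idealD(2)[OF assms(1)] assms(2,3) by blast
qed

lemma set_plus_absorb:
  assumes "right_ideal A" "right_ideal B"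
  shows "A \<subseteq> B \<Longrightarrow> A + B = B" "B \<subseteq> A \<Longrightarrow> A + B = A"
  using subset_set_plus[OF assms] set_plus_subset[of A A B] set_plus_subset[of B A B] assms
  by (simp_all add: subset_antisym)

lemma right_ideal_principal_right_ideal: "right_ideal (principal_right_ideal x)"
  unfolding right_ideal_def
proof (intro conjI ballI allI)
  show "0 \<in> principal_right_ideal x"
    by (auto simp: principal_right_ideal_def intro: exI[of _ 0])
  fix u assume "u \<in> principal_right_ideal x"
  then obtain p where u: "u = x * p" by (auto simp: principal_right_ideal_def)
  show "u * r \<in> principal_right_ideal x" for r
    by (auto simp: principal_right_ideal_def u mult.assoc)
  fix v assume "v \<in> principal_right_ideal x"
  then obtain q where "v = x * q" by (auto simp: principal_right_ideal_def)
  then have "u + v = x * (p + q)" by (simp add: u distrib_left)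
  then show "u + v \<in> principal_right_ideal x" by (auto simp: principal_right_ideal_def)
qed

lemma mem_principal_right_ideal:
  assumes "regular_ring TYPE('a::ring)"
  shows "(x::'a) \<in> principal_right_ideal x"
  using regular_ringE[OF assms, of x] unfolding principal_right_ideal_def
  by (metis (mono_tags) mem_Collect_eq)

lemma principal_right_ideal_subset_iff:
  assumes "regular_ring TYPE('a::ring)" "right_ideal J"
  shows "principal_right_ideal (x::'a) \<subseteq> J \<longleftrightarrow> x \<in> J"
  using mem_principal_right_ideal[OF assms(1), of x] right_idealD(3)[OF assms(2)]
  by (auto simp: principal_right_ideal_def)

section \<open>Sums of principal right ideals\<close>

text \<open>The idempotent \<open>e = a * a'\<close> generates aR. Removing from \<open>b\<close>
  its part \<open>e * b\<close> in aR leaves \<open>d\<close> with \<open>e * d = 0\<close> and aR +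
  bR = eR + dR. The idempotent \<open>f = d * d'\<close> generates dR, and correcting it to
  \<open>g\<close> gives two orthogonal idempotents, for which eR + gR = (e + g)R.\<close>

lemma principal_right_ideal_sum:
  assumes reg: "regular_ring TYPE('a::ring)"
  shows "\<exists>h::'a. principal_right_ideal a + principal_right_ideal b = principal_right_ideal h"
proof -
  obtain a' where a': "a * (a' * a) = a" using reg by (rule regular_ringE)
  define e where "e = a * a'"
  have ea: "e * a = a" and ee: "e * e = e"
    using a' by (simp_all add: e_def mult.assoc) (metis mult.assoc)
  define d where "d = b - e * b"
  obtain d' where d': "d * (d' * d) = d" using reg by (rule regular_ringE)
  have ed: "e * d = 0" by (simp add: d_def right_diff_distrib mult.assoc[symmetric] ee)
  define f where "f = d * d'"
  have fd: "f * d = d" using d' by (simp add: f_def mult.assoc)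
  have ef: "e * f = 0" using ed by (simp add: f_def mult.assoc[symmetric])
  have ff: "f * f = f" using fd by (metis f_def mult.assoc)
  define g where "g = f - f * e" \<comment> \<open>orthogonal to \<open>e\<close>, and \<open>gR = fR\<close>\<close>
  have ge: "g * e = 0" by (simp add: g_def left_diff_distrib mult.assoc ee)
  have eg: "e * g = 0" by (simp add: g_def right_diff_distrib mult.assoc[symmetric] ef)
  have gf: "g * f = f" by (simp add: g_def left_diff_distrib mult.assoc ef ff)
  have gg: "g * g = g" using ge gf by (metis g_def mult.assoc right_diff_distrib)
  define h where "h = e + g"
  let ?A = "principal_right_ideal a" and ?B = "principal_right_ideal b"
    and ?H = "principal_right_ideal h"
  have rA: "right_ideal ?A" and rB: "right_ideal ?B" and rH: "right_ideal ?H"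
    by (rule right_ideal_principal_right_ideal)+
  have rAB: "right_ideal (?A + ?B)" by (rule right_ideal_set_plus[OF rA rB])
  have hH: "h \<in> ?H" by (rule mem_principal_right_ideal[OF reg])
  \<comment> \<open>By orthogonality \<open>h\<close> is a left unit for both \<open>e\<close> and
    \<open>g\<close>, which puts them into hR.\<close>
  have he: "h * e = e" and hg: "h * g = g"
    by (simp_all add: h_def distrib_right ee ge eg gg)
  have eH: "e \<in> ?H" and gH: "g \<in> ?H"
    using right_idealD(3)[OF rH hH, of e] right_idealD(3)[OF rH hH, of g] he hg by simp_all
  have gd: "g * d = d" by (metis gf fd mult.assoc)
  have ebH: "e * b \<in> ?H" by (rule right_idealD(3)[OF rH eH])
  have "a \<in> ?H" "d \<in> ?H"
    using right_idealD(3)[OF rH eH, of a] right_idealD(3)[OF rH gH, of d] ea gd by simp_all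
  moreover from this have "b \<in> ?H" using right_idealD(2)[OF rH ebH, of d] by (simp add: d_def)
  ultimately have 1: "?A + ?B \<subseteq> ?H"
    by (intro set_plus_subset[OF rH]) (simp_all add: principal_right_ideal_subset_iff[OF reg rH])
  \<comment> \<open>For the other inclusion, \<open>e\<close>, \<open>d\<close>, \<open>f\<close>,
    \<open>g\<close> and finally \<open>h\<close> are reached in turn from \<open>a\<close> and
    \<open>b\<close> inside the right ideal aR + bR.\<close>
  have aAB: "a \<in> ?A + ?B" and bAB: "b \<in> ?A + ?B"
    using subset_set_plus[OF rA rB] mem_principal_right_ideal[OF reg] by blast+
  have eAB: "e \<in> ?A + ?B" unfolding e_def by (rule right_idealD(3)[OF rAB aAB])
  have "d \<in> ?A + ?B" unfolding d_def
    by (rule right_ideal_diff[OF reg rAB bAB right_idealD(3)[OF rAB eAB]])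
  then have fAB: "f \<in> ?A + ?B" unfolding f_def by (rule right_idealD(3)[OF rAB])
  have "g \<in> ?A + ?B" unfolding g_def
    by (rule right_ideal_diff[OF reg rAB fAB right_idealD(3)[OF rAB fAB]])
  then have "h \<in> ?A + ?B" unfolding h_def by (rule right_idealD(2)[OF rAB eAB])
  then have "?H \<subseteq> ?A + ?B" by (simp add: principal_right_ideal_subset_iff[OF reg rAB])
  with 1 show ?thesis by blast
qed

text \<open>The sum is below every right ideal containing both summands, and it is itself principal,
  so it is also the least upper bound among the principal right ideals.\<close>

lemma join_principal_right_ideals:
  assumes reg: "regular_ring TYPE('a::ring)"
    and "X \<in> range (principal_right_ideal :: 'a \<Rightarrow> _)" "Y \<in> range principal_right_ideal"
  shows "X \<squnion>\<^bsub>principal_right_ideals\<^esub> Y = X + Y"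
proof -
  obtain x y where xy: "X = principal_right_ideal x" "Y = principal_right_ideal y" using assms by blast
  have r: "right_ideal X" "right_ideal Y" by (simp_all add: xy right_ideal_principal_right_ideal)
  have "X + Y \<in> range principal_right_ideal"
    using principal_right_ideal_sum[OF reg, of x y] xy by auto
  moreover have "X + Y \<subseteq> V" if "V \<in> range principal_right_ideal" "X \<subseteq> V" "Y \<subseteq> V" for V :: "'a set"
    using that right_ideal_principal_right_ideal by (metis imageE set_plus_subset)
  ultimately show ?thesis unfolding principal_right_ideals_def
    using assms(2,3) subset_set_plus[OF r] by (intro join_inclusion_order) simp_all
qed

subsection \<open>Lattice ideals are right ideals\<close>

text \<open>Stated for all right ideals: both maps of the theorem are studied first as a
  correspondence between right ideals of the ring and arbitrary ideals of the lattice. Neutrality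
  enters only later, as a condition on the right ideal.\<close>

lemma ring_ideal_of_neutral_ideal_of:
  assumes "regular_ring TYPE('a::ring)" "right_ideal (J :: 'a set)"
  shows "ring_ideal_of (neutral_ideal_of J) = J"
  using principal_right_ideal_subset_iff[OF assms]
  by (auto simp: ring_ideal_of_def neutral_ideal_of_def principal_right_ideals_def)

lemma neutral_ideal_of_subset_iff:
  assumes "regular_ring TYPE('a::ring)" "right_ideal (A :: 'a set)" "right_ideal B"
  shows "neutral_ideal_of A \<subseteq> neutral_ideal_of B \<longleftrightarrow> A \<subseteq> B"
proof
  assume "neutral_ideal_of A \<subseteq> neutral_ideal_of B"
  then have "ring_ideal_of (neutral_ideal_of A) \<subseteq> ring_ideal_of (neutral_ideal_of B)"
    by (auto simp: ring_ideal_of_def)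
  then show "A \<subseteq> B" using assms by (simp add: ring_ideal_of_neutral_ideal_of)
qed (auto simp: neutral_ideal_of_def)

lemma lattice_ideal_neutral_ideal_of:
  assumes reg: "regular_ring TYPE('a::ring)" and J: "right_ideal (J :: 'a set)"
  shows "lattice_ideal principal_right_ideals (neutral_ideal_of J)"
  unfolding lattice_ideal_def
proof (intro conjI ballI impI)
  show "neutral_ideal_of J \<subseteq> carrier principal_right_ideals" by (auto simp: neutral_ideal_of_def)
  have "principal_right_ideal 0 \<in> neutral_ideal_of J"
    using right_idealD(1)[OF J] principal_right_ideal_subset_iff[OF reg J, of 0]
    by (auto simp: neutral_ideal_of_def principal_right_ideals_def)
  then show "neutral_ideal_of J \<noteq> {}" by blast
  fix X assume X: "X \<in> neutral_ideal_of J"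
  show "Y \<in> neutral_ideal_of J"
    if "Y \<in> carrier principal_right_ideals" "Y \<sqsubseteq>\<^bsub>principal_right_ideals\<^esub> X" for Y
    using that X by (auto simp: neutral_ideal_of_def principal_right_ideals_def)
  fix Y assume Y: "Y \<in> neutral_ideal_of J"
  obtain x y where xy: "X = principal_right_ideal x" "Y = principal_right_ideal y"
    using X Y by (auto simp: neutral_ideal_of_def principal_right_ideals_def)
  have "X + Y \<subseteq> J" using X Y J by (intro set_plus_subset) (auto simp: neutral_ideal_of_def)
  then show "X \<squnion>\<^bsub>principal_right_ideals\<^esub> Y \<in> neutral_ideal_of J"
    using principal_right_ideal_sum[OF reg, of x y]
    by (subst join_principal_right_ideals[OF reg])
      (auto simp: neutral_ideal_of_def principal_right_ideals_def xy)
qed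

text \<open>If \<open>x\<close> lies in some member \<open>Y\<close> of \<open>P\<close>, then xR is
  below \<open>Y\<close> and hence in \<open>P\<close>. So closure of \<open>ring_ideal_of P\<close>
  under addition follows from x + y lying in xR + yR, which is the join of two members of
  \<open>P\<close>.\<close>

lemma lattice_ideal_imp_neutral_ideal_of:
  assumes reg: "regular_ring TYPE('a::ring)"
    and P: "lattice_ideal principal_right_ideals (P :: 'a set set)"
  shows "right_ideal (ring_ideal_of P)" and "neutral_ideal_of (ring_ideal_of P) = P"
proof -
  let ?p = "principal_right_ideal :: 'a \<Rightarrow> 'a set"
  have sub: "P \<subseteq> range ?p" and ne: "P \<noteq> {}"
    and down: "\<And>x Y. Y \<in> P \<Longrightarrow> ?p x \<subseteq> Y \<Longrightarrow> ?p x \<in> P"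
    and join: "\<And>X Y. X \<in> P \<Longrightarrow> Y \<in> P \<Longrightarrow> X \<squnion>\<^bsub>principal_right_ideals\<^esub> Y \<in> P"
    using P by (auto simp: lattice_ideal_def principal_right_ideals_def)
  have mem: "?p x \<in> P" if "Y \<in> P" "x \<in> Y" for x Y
  proof (rule down[OF that(1)])
    have "right_ideal Y" using sub that(1) right_ideal_principal_right_ideal by blast
    then show "?p x \<subseteq> Y" using that(2) by (simp add: principal_right_ideal_subset_iff[OF reg])
  qed
  have self: "x \<in> ?p x" for x by (rule mem_principal_right_ideal[OF reg])
  note pr = right_ideal_principal_right_ideal
  show J: "right_ideal (ring_ideal_of P)"
    unfolding right_ideal_def ring_ideal_of_def mem_Collect_eq
  proof (intro conjI ballI allI)
    obtain x where "?p x \<in> P" using sub ne by blast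
    then show "?p 0 \<in> P" by (rule mem) (rule right_idealD(1)[OF pr])
    fix x y r assume x: "x \<in> {x. ?p x \<in> P}" and y: "y \<in> {x. ?p x \<in> P}"
    show "?p (x + y) \<in> P"
    proof (rule mem)
      show "?p x \<squnion>\<^bsub>principal_right_ideals\<^esub> ?p y \<in> P" using x y by (simp add: join)
      show "x + y \<in> ?p x \<squnion>\<^bsub>principal_right_ideals\<^esub> ?p y"
        by (subst join_principal_right_ideals[OF reg]) (auto intro: set_plus_intro self)
    qed
  next
    fix x r assume x: "x \<in> {x. ?p x \<in> P}"
    then show "?p (x * r) \<in> P" using mem right_idealD(3)[OF pr self] by blast
  qed
  show "neutral_ideal_of (ring_ideal_of P) = P"
    unfolding neutral_ideal_of_def
    using principal_right_ideal_subset_iff[OF reg J] sub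
    by (auto simp: ring_ideal_of_def principal_right_ideals_def)
qed

lemma lattice_ideal_neutral_ideal_ofE:
  assumes "regular_ring TYPE('a::ring)" "lattice_ideal principal_right_ideals (P :: 'a set set)"
  obtains J where "right_ideal J" "P = neutral_ideal_of J"
  using lattice_ideal_imp_neutral_ideal_of[OF assms] by metis

text \<open>Together with \<open>join_neutral_ideal_of\<close> this turns lattice terms in ideals of
  the lattice into intersections and sums of right ideals, where neutrality can be tested on
  elements.\<close>

lemma meet_neutral_ideal_of:
  assumes reg: "regular_ring TYPE('a::ring)" and "right_ideal (A :: 'a set)" "right_ideal B"
  shows "neutral_ideal_of A \<sqinter>\<^bsub>lattice_ideals principal_right_ideals\<^esub> neutral_ideal_of B
    = neutral_ideal_of (A \<inter> B)"
  unfolding lattice_ideals_def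
proof (rule meet_inclusion_order)
  show "neutral_ideal_of (A \<inter> B) \<subseteq> neutral_ideal_of A" "neutral_ideal_of (A \<inter> B) \<subseteq> neutral_ideal_of B"
    "\<forall>V\<in>{I. lattice_ideal principal_right_ideals I}.
      V \<subseteq> neutral_ideal_of A \<longrightarrow> V \<subseteq> neutral_ideal_of B \<longrightarrow> V \<subseteq> neutral_ideal_of (A \<inter> B)"
    unfolding neutral_ideal_of_def by blast+
qed (simp_all add: assms lattice_ideal_neutral_ideal_of right_ideal_Int)

lemma join_neutral_ideal_of:
  assumes reg: "regular_ring TYPE('a::ring)" and A: "right_ideal (A :: 'a set)" and B: "right_ideal B"
  shows "neutral_ideal_of A \<squnion>\<^bsub>lattice_ideals principal_right_ideals\<^esub> neutral_ideal_of B
    = neutral_ideal_of (A + B)"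
  unfolding lattice_ideals_def
proof (rule join_inclusion_order)
  have AB: "right_ideal (A + B)" by (rule right_ideal_set_plus[OF A B])
  then show "neutral_ideal_of (A + B) \<in> {I. lattice_ideal principal_right_ideals I}"
    by (simp add: lattice_ideal_neutral_ideal_of[OF reg])
  show "neutral_ideal_of A \<subseteq> neutral_ideal_of (A + B)" "neutral_ideal_of B \<subseteq> neutral_ideal_of (A + B)"
    using subset_set_plus[OF A B] by (simp_all add: neutral_ideal_of_subset_iff[OF reg] A B AB)
  show "\<forall>V\<in>{I. lattice_ideal principal_right_ideals I}. neutral_ideal_of A \<subseteq> V \<longrightarrow>
      neutral_ideal_of B \<subseteq> V \<longrightarrow> neutral_ideal_of (A + B) \<subseteq> V"
  proof (intro ballI impI)
    fix V assume "V \<in> {I. lattice_ideal principal_right_ideals (I :: 'a set set)}"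
    then have "lattice_ideal principal_right_ideals V" by simp
    then obtain J where J: "right_ideal J" "V = neutral_ideal_of J"
      by (rule lattice_ideal_neutral_ideal_ofE[OF reg])
    assume "neutral_ideal_of A \<subseteq> V" "neutral_ideal_of B \<subseteq> V"
    then show "neutral_ideal_of (A + B) \<subseteq> V"
      using J A B AB by (simp add: neutral_ideal_of_subset_iff[OF reg] set_plus_subset)
  qed
qed (use lattice_ideal_neutral_ideal_of[OF reg] A B in simp_all)

subsection \<open>Neutral ideals are two-sided ideals\<close>

lemma two_sided_ideal_iff_right_ideal:
  assumes "regular_ring TYPE('a::ring)"
  shows "two_sided_ideal (I :: 'a set) \<longleftrightarrow> right_ideal I \<and> (\<forall>x\<in>I. \<forall>r. r * x \<in> I)"
  using right_ideal_uminus[OF assms] unfolding two_sided_ideal_def right_ideal_def by blast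

section \<open>From neutral to two-sided\<close>

text \<open>With the idempotent \<open>e = x * b\<close> in \<open>I\<close> and
  \<open>e * x = x\<close>, it suffices to find \<open>r * e\<close> in \<open>I\<close>, because r
  x = (r e) x. The part \<open>e * (r * e)\<close> is in \<open>I\<close> already, and
  distributivity takes care of the remainder \<open>y\<close>.\<close>

lemma two_sided_ideal_if_distributive:
  assumes reg: "regular_ring TYPE('a::ring)" and I: "right_ideal (I :: 'a set)"
    and dist: "\<And>X Y. right_ideal X \<Longrightarrow> right_ideal Y \<Longrightarrow> I \<inter> (X + Y) \<subseteq> (I \<inter> X) + (I \<inter> Y)"
  shows "two_sided_ideal I"
  unfolding two_sided_ideal_iff_right_ideal[OF reg]
proof (intro conjI ballI allI)
  show "right_ideal I" by (rule I)
  fix x r assume x: "x \<in> I"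
  obtain b where b: "x * (b * x) = x" using reg by (rule regular_ringE)
  define e where "e = x * b"
  have ex: "e * x = x" and ee: "e * e = e"
    using b by (simp_all add: e_def mult.assoc) (metis mult.assoc)
  have e: "e \<in> I" unfolding e_def by (rule right_idealD(3)[OF I x])
  define y where "y = r * e - e * (r * e)"
  have ye: "y * e = y" by (simp add: y_def left_diff_distrib mult.assoc ee)
  have ey: "e * y = 0" by (simp add: y_def right_diff_distrib mult.assoc[symmetric] ee)
  \<comment> \<open>As \<open>y * e = y\<close>, the right ideal (e + y)R is the graph of left
    multiplication by \<open>y\<close> on eR. Like eR, it is a complement of yR in eR + yR.\<close>
  let ?X = "principal_right_ideal (e + y)" and ?Y = "principal_right_ideal y"
  have rX: "right_ideal ?X" and rY: "right_ideal ?Y" by (rule right_ideal_principal_right_ideal)+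
  have "(e + y) + - y \<in> ?X + ?Y"
    by (intro set_plus_intro mem_principal_right_ideal[OF reg] right_ideal_uminus[OF reg rY])
  then have "e \<in> ?X + ?Y" by simp
  with dist[OF rX rY] e have "e \<in> (I \<inter> ?X) + (I \<inter> ?Y)" by blast
  then obtain u v where "e = u + v" "u \<in> I \<inter> ?X" "v \<in> I \<inter> ?Y" by (rule set_plus_elim)
  then have uv: "u \<in> I" "u \<in> ?X" "v \<in> ?Y" "e = u + v" by simp_all
  then obtain s t where st: "u = (e + y) * s" "v = y * t" by (auto simp: principal_right_ideal_def)
  have "e = (e + y) * s + y * t" using uv(4) unfolding st .
  \<comment> \<open>Left multiplication by \<open>e\<close> annihilates yR, which leaves
    \<open>e * s = e\<close>. Then also \<open>y * s = y\<close>, so the component \<open>u\<close>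
    from \<open>I\<close> is exactly \<open>e + y\<close>.\<close>
  then have "e * e = e * ((e + y) * s + y * t)" by (rule arg_cong)
  also have "\<dots> = e * s" by (simp add: distrib_left distrib_right mult.assoc[symmetric] ee ey)
  finally have es: "e * s = e" by (simp add: ee)
  have "y * s = y" by (metis es ye mult.assoc)
  then have "u = e + y" using st es by (simp add: distrib_right)
  then have "y \<in> I" using right_ideal_diff[OF reg I uv(1) e] by simp
  then have "y + e * (r * e) \<in> I" by (intro right_idealD(2,3)[OF I] e)
  then have "r * e \<in> I" by (simp add: y_def)
  then have "(r * e) * x \<in> I" by (rule right_idealD(3)[OF I])
  then show "r * x \<in> I" by (simp add: mult.assoc ex)
qed

section \<open>From two-sided to neutral\<close>

text \<open>For i = x + y in \<open>I\<close> with i (b i) = i, right multiplication by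
  \<open>b * i\<close> fixes the sum and moves both summands into \<open>I\<close>, since
  \<open>I\<close> is also a left ideal. Thus intersecting with \<open>I\<close> preserves
  sums.\<close>

lemma two_sided_ideal_Int_set_plus:
  assumes reg: "regular_ring TYPE('a::ring)" and I: "two_sided_ideal (I :: 'a set)"
    and X: "right_ideal X" and Y: "right_ideal Y"
  shows "(X + Y) \<inter> I = (X \<inter> I) + (Y \<inter> I)"
proof
  have rI: "right_ideal I" and lI: "\<And>x r. x \<in> I \<Longrightarrow> r * x \<in> I"
    using I by (simp_all add: two_sided_ideal_iff_right_ideal[OF reg])
  show "(X \<inter> I) + (Y \<inter> I) \<subseteq> (X + Y) \<inter> I"
    by (intro Int_greatest set_plus_mono2 set_plus_subset[OF rI]) auto
  show "(X + Y) \<inter> I \<subseteq> (X \<inter> I) + (Y \<inter> I)"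
  proof
    fix i assume "i \<in> (X + Y) \<inter> I"
    then have iI: "i \<in> I" and "i \<in> X + Y" by simp_all
    from this(2) obtain x y where i: "i = x + y" "x \<in> X" "y \<in> Y" by (rule set_plus_elim)
    obtain b where "i * (b * i) = i" using reg by (rule regular_ringE)
    then have "i = x * (b * i) + y * (b * i)" by (metis i(1) distrib_right)
    moreover have "x * (b * i) \<in> X \<inter> I" "y * (b * i) \<in> Y \<inter> I"
      using iI i(2,3) lI right_idealD(3)[OF X] right_idealD(3)[OF Y] by simp_all
    ultimately show "i \<in> (X \<inter> I) + (Y \<inter> I)" by (metis set_plus_intro)
  qed
qed

text \<open>If w = x + i = y + j, then k = x - y is in \<open>I\<close>. Subtracting from
  \<open>x\<close> and from \<open>y\<close> their right multiples by \<open>b * k\<close>, where k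
  (b k) = k, yields one common element \<open>z\<close> of \<open>X \<inter> Y\<close>, and w - z
  stays in \<open>I\<close>.\<close>

lemma two_sided_ideal_set_plus_Int:
  assumes reg: "regular_ring TYPE('a::ring)" and I: "two_sided_ideal (I :: 'a set)"
    and X: "right_ideal X" and Y: "right_ideal Y"
  shows "(X \<inter> Y) + I = (X + I) \<inter> (Y + I)"
proof
  have rI: "right_ideal I" and lI: "\<And>x r. x \<in> I \<Longrightarrow> r * x \<in> I"
    using I by (simp_all add: two_sided_ideal_iff_right_ideal[OF reg])
  show "(X \<inter> Y) + I \<subseteq> (X + I) \<inter> (Y + I)"
    by (intro Int_greatest set_plus_mono2) auto
  show "(X + I) \<inter> (Y + I) \<subseteq> (X \<inter> Y) + I"
  proof
    fix w assume "w \<in> (X + I) \<inter> (Y + I)"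
    then have "w \<in> X + I" and "w \<in> Y + I" by simp_all
    then obtain x i y j where w: "x \<in> X" "i \<in> I" "w = x + i" "y \<in> Y" "j \<in> I" "w = y + j"
      by (elim set_plus_elim)
    define k where "k = x - y"
    have "x + i = y + j" by (rule trans[OF w(3)[symmetric] w(6)])
    then have "k = j - i" by (simp add: k_def algebra_simps)
    then have k: "k \<in> I" using right_ideal_diff[OF reg rI w(5,2)] by simp
    obtain b where b: "k * (b * k) = k" using reg by (rule regular_ringE)
    define z where "z = x - x * (b * k)"
    \<comment> \<open>\<open>(x - y) (1 - bk) = 0\<close>, although there need not be a unit\<close>
    have "x * (b * k) - y * (b * k) = x - y" using b by (metis k_def left_diff_distrib)
    then have "z = y - y * (b * k)" by (simp add: z_def algebra_simps)
    then have "z \<in> Y" using right_ideal_diff[OF reg Y] right_idealD(3)[OF Y] w by simp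
    moreover have "z \<in> X" unfolding z_def by (intro right_ideal_diff[OF reg X] right_idealD(3)[OF X] w)
    ultimately have "z \<in> X \<inter> Y" by simp
    moreover have "x * (b * k) + i \<in> I" by (intro right_idealD(2)[OF rI] lI k w)
    moreover have "w = z + (x * (b * k) + i)" by (simp add: z_def w(3))
    ultimately show "w \<in> (X \<inter> Y) + I" by (metis set_plus_intro)
  qed
qed

text \<open>For z = w + i with i (b i) = i, the element \<open>i\<close> equals z (b i) - w (b i).
  The first term is in \<open>Z \<inter> I\<close>, hence in \<open>W\<close>, and so
  \<open>i\<close> and \<open>z\<close> are in \<open>W\<close>. Inclusions can therefore be tested
  on the traces modulo and inside \<open>I\<close>.\<close>

lemma subset_if_traces_subset:
  assumes reg: "regular_ring TYPE('a::ring)" and I: "two_sided_ideal (I :: 'a set)"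
    and Z: "right_ideal Z" and W: "right_ideal W"
    and "Z \<inter> I \<subseteq> W \<inter> I" "Z + I \<subseteq> W + I"
  shows "Z \<subseteq> W"
proof
  have rI: "right_ideal I" and lI: "\<And>x r. x \<in> I \<Longrightarrow> r * x \<in> I"
    using I by (simp_all add: two_sided_ideal_iff_right_ideal[OF reg])
  fix z assume z: "z \<in> Z"
  then have "z \<in> W + I" using assms(6) subset_set_plus(1)[OF Z rI] by blast
  then obtain w i where w: "z = w + i" "w \<in> W" "i \<in> I" by (rule set_plus_elim)
  obtain b where b: "i * (b * i) = i" using reg by (rule regular_ringE)
  have i: "i = z * (b * i) - w * (b * i)" by (simp add: w(1) distrib_right b)
  have "z * (b * i) \<in> Z \<inter> I" by (intro IntI right_idealD(3)[OF Z z] lI w(3))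
  then have "z * (b * i) \<in> W" using assms(5) by blast
  then have "z * (b * i) - w * (b * i) \<in> W"
    by (rule right_ideal_diff[OF reg W _ right_idealD(3)[OF W w(2)]])
  then have "i \<in> W" by (simp only: i[symmetric])
  then show "z \<in> W" using w right_idealD(2)[OF W] by simp
qed

text \<open>
  The intended \<open>F\<close> is \<open>{T, A, B, A \<inter> B, A + B}\<close>, with \<open>T\<close> a common upper or lower bound of \<open>A\<close> and \<open>B\<close>.
\<close>

lemma almost_chain_closed:
  assumes "\<And>P. P \<in> F \<Longrightarrow> right_ideal P" "A \<inter> B \<in> F" "A + B \<in> F"
    and "\<And>P Q. P \<in> F \<Longrightarrow> Q \<in> F \<Longrightarrow> P \<subseteq> Q \<or> Q \<subseteq> P \<or> {P, Q} = {A, B}"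
    and "P \<in> F" "Q \<in> F"
  shows "P \<inter> Q \<in> F" "P + Q \<in> F"
proof -
  consider "P \<subseteq> Q" | "Q \<subseteq> P" | "P = A" "Q = B" | "P = B" "Q = A"
    using assms(4)[OF assms(5,6)] by (auto simp: doubleton_eq_iff)
  then have "P \<inter> Q \<in> F \<and> P + Q \<in> F"
    using assms by cases (auto simp: set_plus_absorb Int_absorb1 Int_absorb2 Int_commute add.commute)
  then show "P \<inter> Q \<in> F" "P + Q \<in> F" by simp_all
qed

text \<open>With at most one incomparable pair, three members leave few cases: \<open>P\<close> is
  below \<open>Q\<close> or \<open>R\<close>, or \<open>Q\<close> and \<open>R\<close> are
  comparable, or both are below \<open>P\<close>. The inclusion is immediate in each.\<close>

lemma almost_chain_distributive:
  assumes ri: "\<And>P. P \<in> F \<Longrightarrow> right_ideal P" and AB: "A \<in> F" "B \<in> F"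
    and cmp: "\<And>P Q. P \<in> F \<Longrightarrow> Q \<in> F \<Longrightarrow> P \<subseteq> Q \<or> Q \<subseteq> P \<or> {P, Q} = {A, B}"
    and PQR: "P \<in> F" "Q \<in> F" "R \<in> F"
  shows "P \<inter> (Q + R) \<subseteq> (P \<inter> Q) + (P \<inter> R)"
proof -
  have ge: "P \<inter> Q \<subseteq> (P \<inter> Q) + (P \<inter> R)" "P \<inter> R \<subseteq> (P \<inter> Q) + (P \<inter> R)"
    using subset_set_plus[of "P \<inter> Q" "P \<inter> R"] ri PQR by (simp_all add: right_ideal_Int)
  consider "P \<subseteq> Q \<or> P \<subseteq> R" | "Q \<subseteq> R" | "R \<subseteq> Q" | "Q \<subseteq> P" "R \<subseteq> P"
    using cmp[OF PQR(1,2)] cmp[OF PQR(1,3)] cmp[OF PQR(2,3)] by (auto simp: doubleton_eq_iff)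
  then show ?thesis
  proof cases
    case 1 then show ?thesis using ge by blast
  next
    case 2 then show ?thesis using ge set_plus_absorb(1)[OF ri ri, OF PQR(2,3)] by simp
  next
    case 3 then show ?thesis using ge set_plus_absorb(2)[OF ri ri, OF PQR(2,3)] by simp
  next
    case 4 then show ?thesis by (simp add: Int_absorb1)
  qed
qed

text \<open>An explicit distributive set closed under both operations serves as an upper bound for
  the generated sublattice, so no induction over lattice terms occurs. It consists of the right
  ideals whose two traces lie in fixed distributive families.\<close>

lemma distributive_set_of_right_ideals:
  assumes reg: "regular_ring TYPE('a::ring)" and I: "two_sided_ideal (I :: 'a set)"
    and X: "right_ideal X" and Y: "right_ideal Y"
  obtains S where "I \<in> S" "X \<in> S" "Y \<in> S"
    "\<forall>Z\<in>S. right_ideal Z"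
    "\<forall>Z\<in>S. \<forall>W\<in>S. Z \<inter> W \<in> S \<and> Z + W \<in> S"
    "\<forall>Z\<in>S. \<forall>U\<in>S. \<forall>V\<in>S. Z \<inter> (U + V) = (Z \<inter> U) + (Z \<inter> V)"
proof
  have rI: "right_ideal I" using I by (simp add: two_sided_ideal_iff_right_ideal[OF reg])
  note ri = right_ideal_Int right_ideal_set_plus rI X Y
  \<comment> \<open>The traces of \<open>X\<close> and \<open>Y\<close> generate these families
    together with \<open>I\<close>, which is the top of \<open>F\<close> and the bottom of
    \<open>G\<close>. In each, only the two generating traces can be incomparable.\<close>
  define F where "F = {I, X \<inter> I, Y \<inter> I, (X \<inter> I) \<inter> (Y \<inter> I), (X \<inter> I) + (Y \<inter> I)}"
  define G where "G = {I, X + I, Y + I, (X + I) \<inter> (Y + I), (X + I) + (Y + I)}"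
  define S where "S = {Z. right_ideal Z \<and> Z \<inter> I \<in> F \<and> Z + I \<in> G}"
  have rF: "right_ideal P" if "P \<in> F" for P using that by (auto simp: F_def ri)
  have rG: "right_ideal P" if "P \<in> G" for P using that by (auto simp: G_def ri)
  have leF: "(X \<inter> I) + (Y \<inter> I) \<subseteq> I" by (intro set_plus_subset rI) auto
  have F2: "X \<inter> I \<subseteq> (X \<inter> I) + (Y \<inter> I)" "Y \<inter> I \<subseteq> (X \<inter> I) + (Y \<inter> I)"
    by (intro subset_set_plus ri)+
  have leG: "I \<subseteq> X + I" "I \<subseteq> Y + I" by (intro subset_set_plus ri)+
  have G2: "X + I \<subseteq> (X + I) + (Y + I)" "Y + I \<subseteq> (X + I) + (Y + I)"
    by (intro subset_set_plus ri)+
  have cF: "P \<subseteq> Q \<or> Q \<subseteq> P \<or> {P, Q} = {X \<inter> I, Y \<inter> I}" if "P \<in> F" "Q \<in> F" for P Q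
    using that F2 leF unfolding F_def insert_iff empty_iff
    by (elim disjE) (simp_all; blast)+
  have cG: "P \<subseteq> Q \<or> Q \<subseteq> P \<or> {P, Q} = {X + I, Y + I}" if "P \<in> G" "Q \<in> G" for P Q
    using that G2 leG unfolding G_def insert_iff empty_iff
    by (elim disjE) (simp_all; blast)+
  have clF: "P \<inter> Q \<in> F" "P + Q \<in> F" if "P \<in> F" "Q \<in> F" for P Q
    by (rule almost_chain_closed[OF rF _ _ cF that]; simp add: F_def)+
  have clG: "P \<inter> Q \<in> G" "P + Q \<in> G" if "P \<in> G" "Q \<in> G" for P Q
    by (rule almost_chain_closed[OF rG _ _ cG that]; simp add: G_def)+
  have dF: "P \<inter> (Q + R) \<subseteq> (P \<inter> Q) + (P \<inter> R)" if "P \<in> F" "Q \<in> F" "R \<in> F" for P Q R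
    by (rule almost_chain_distributive[OF rF _ _ cF that]; simp add: F_def)
  have dG: "P \<inter> (Q + R) \<subseteq> (P \<inter> Q) + (P \<inter> R)" if "P \<in> G" "Q \<in> G" "R \<in> G" for P Q R
    by (rule almost_chain_distributive[OF rG _ _ cG that]; simp add: G_def)
  have II: "I + I = I" by (intro set_plus_absorb rI order_refl)
  have trI: "(Z \<inter> W) \<inter> I = (Z \<inter> I) \<inter> (W \<inter> I)" for Z W by blast
  have trP: "(Z + W) + I = (Z + I) + (W + I)" for Z W
  proof -
    have "(Z + I) + (W + I) = (Z + W) + (I + I)" by (simp only: ac_simps)
    then show ?thesis by (simp add: II)
  qed
  note tr = trI trP two_sided_ideal_Int_set_plus[OF reg I] two_sided_ideal_set_plus_Int[OF reg I]
  show "I \<in> S" "X \<in> S" "Y \<in> S" by (simp_all add: S_def F_def G_def II rI X Y)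
  show rS: "\<forall>Z\<in>S. right_ideal Z" by (simp add: S_def)
  show "\<forall>Z\<in>S. \<forall>W\<in>S. Z \<inter> W \<in> S \<and> Z + W \<in> S"
    using clF clG by (simp add: S_def tr right_ideal_Int right_ideal_set_plus)
  show "\<forall>Z\<in>S. \<forall>U\<in>S. \<forall>V\<in>S. Z \<inter> (U + V) = (Z \<inter> U) + (Z \<inter> V)"
  proof (intro ballI)
    fix Z U V assume S: "Z \<in> S" "U \<in> S" "V \<in> S"
    then have r: "right_ideal Z" "right_ideal U" "right_ideal V" using rS by simp_all
    note r' = r right_ideal_Int right_ideal_set_plus
    show "Z \<inter> (U + V) = (Z \<inter> U) + (Z \<inter> V)"
    proof
      show "(Z \<inter> U) + (Z \<inter> V) \<subseteq> Z \<inter> (U + V)"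
        by (intro Int_greatest set_plus_mono2 set_plus_subset[OF r(1)]) auto
      show "Z \<inter> (U + V) \<subseteq> (Z \<inter> U) + (Z \<inter> V)"
      \<comment> \<open>Both traces commute with both operations, so the inclusion reduces to
        distributivity within \<open>F\<close> and within \<open>G\<close>.\<close>
      proof (rule subset_if_traces_subset[OF reg I])
        show "Z \<inter> (U + V) \<inter> I \<subseteq> ((Z \<inter> U) + (Z \<inter> V)) \<inter> I"
          using S dF by (simp add: tr r' S_def del: Int_subset_iff)
        show "Z \<inter> (U + V) + I \<subseteq> (Z \<inter> U) + (Z \<inter> V) + I"
          using S dG by (simp add: tr r' S_def)
      qed (intro r')+
    qed
  qed
qed

text \<open>One direction needs distributivity only at the three generators. In the other, the image
  of the set \<open>S\<close> is a sublattice containing the generators, hence contains the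
  generated sublattice, and distributivity passes to subsets.\<close>

lemma neutral_ideal_neutral_ideal_of_iff:
  assumes reg: "regular_ring TYPE('a::ring)" and I: "right_ideal (I :: 'a set)"
  shows "neutral_ideal principal_right_ideals (neutral_ideal_of I) \<longleftrightarrow> two_sided_ideal I"
proof
  let ?L = "principal_right_ideals :: 'a set gorder"
  note li = lattice_ideal_neutral_ideal_of[OF reg]
  note ops = meet_neutral_ideal_of[OF reg] join_neutral_ideal_of[OF reg]
  note ri = right_ideal_Int right_ideal_set_plus
  {
    assume neut: "neutral_ideal ?L (neutral_ideal_of I)"
    show "two_sided_ideal I"
    proof (rule two_sided_ideal_if_distributive[OF reg I])
      fix X Y :: "'a set" assume X: "right_ideal X" and Y: "right_ideal Y"
      let ?G = "generated_sublattice (lattice_ideals ?L)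
        {neutral_ideal_of I, neutral_ideal_of X, neutral_ideal_of Y}"
      have "distributive_on (lattice_ideals ?L) ?G"
        using neut li[OF X] li[OF Y] by (simp add: neutral_ideal_def)
      moreover have "neutral_ideal_of I \<in> ?G" "neutral_ideal_of X \<in> ?G" "neutral_ideal_of Y \<in> ?G"
        by (auto simp: generated_sublattice_def)
      ultimately have "neutral_ideal_of I \<sqinter>\<^bsub>lattice_ideals ?L\<^esub>
          (neutral_ideal_of X \<squnion>\<^bsub>lattice_ideals ?L\<^esub> neutral_ideal_of Y) =
          (neutral_ideal_of I \<sqinter>\<^bsub>lattice_ideals ?L\<^esub> neutral_ideal_of X) \<squnion>\<^bsub>lattice_ideals ?L\<^esub>
          (neutral_ideal_of I \<sqinter>\<^bsub>lattice_ideals ?L\<^esub> neutral_ideal_of Y)"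
        unfolding distributive_on_def by simp
      then have "neutral_ideal_of (I \<inter> (X + Y)) = neutral_ideal_of ((I \<inter> X) + (I \<inter> Y))"
        by (simp add: ops ri I X Y)
      then show "I \<inter> (X + Y) \<subseteq> (I \<inter> X) + (I \<inter> Y)"
        using neutral_ideal_of_subset_iff[OF reg, of "I \<inter> (X + Y)" "(I \<inter> X) + (I \<inter> Y)"]
        by (simp add: ri I X Y)
    qed
  }
  {
    assume two: "two_sided_ideal I"
    show "neutral_ideal ?L (neutral_ideal_of I)"
      unfolding neutral_ideal_def
    proof (intro conjI allI impI)
      show "lattice_ideal ?L (neutral_ideal_of I)" by (rule li[OF I])
      fix P Q assume P: "lattice_ideal ?L P" and Q: "lattice_ideal ?L Q"
      obtain X where X: "right_ideal X" "P = neutral_ideal_of X"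
        by (rule lattice_ideal_neutral_ideal_ofE[OF reg P])
      obtain Y where Y: "right_ideal Y" "Q = neutral_ideal_of Y"
        by (rule lattice_ideal_neutral_ideal_ofE[OF reg Q])
      obtain S where S: "I \<in> S" "X \<in> S" "Y \<in> S"
        and rS: "\<forall>Z\<in>S. right_ideal Z"
        and cS: "\<forall>Z\<in>S. \<forall>W\<in>S. Z \<inter> W \<in> S \<and> Z + W \<in> S"
        and dS: "\<forall>Z\<in>S. \<forall>U\<in>S. \<forall>V\<in>S. Z \<inter> (U + V) = (Z \<inter> U) + (Z \<inter> V)"
        by (rule distributive_set_of_right_ideals[OF reg two X(1) Y(1)])
      have "sublattice (lattice_ideals ?L) (neutral_ideal_of ` S)"
        unfolding sublattice_def
      proof (intro conjI ballI)
        show "neutral_ideal_of ` S \<subseteq> carrier (lattice_ideals ?L)"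
          by (intro image_subsetI) (simp add: lattice_ideals_def li rS)
        fix P Q assume "P \<in> neutral_ideal_of ` S" "Q \<in> neutral_ideal_of ` S"
        then obtain Z W where "P = neutral_ideal_of Z" "Z \<in> S" "Q = neutral_ideal_of W" "W \<in> S"
          by (elim imageE)
        then show "P \<sqinter>\<^bsub>lattice_ideals ?L\<^esub> Q \<in> neutral_ideal_of ` S"
          and "P \<squnion>\<^bsub>lattice_ideals ?L\<^esub> Q \<in> neutral_ideal_of ` S"
          by (simp_all add: ops rS cS)
      qed
      then have "generated_sublattice (lattice_ideals ?L) {neutral_ideal_of I, P, Q} \<subseteq> neutral_ideal_of ` S"
        unfolding generated_sublattice_def using S X Y by (intro Inter_lower) simp
      moreover have "distributive_on (lattice_ideals ?L) (neutral_ideal_of ` S)"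
        unfolding distributive_on_def by (simp add: ops rS cS dS)
      ultimately show "distributive_on (lattice_ideals ?L)
          (generated_sublattice (lattice_ideals ?L) {neutral_ideal_of I, P, Q})"
        unfolding distributive_on_def by blast
    qed
  }
qed

section \<open>The lattice of two-sided ideals and the isomorphisms\<close>

lemma lattice_two_sided_ideals:
  assumes reg: "regular_ring TYPE('a::ring)"
  shows "lattice (two_sided_ideals :: 'a set gorder)"
  unfolding two_sided_ideals_def
proof (rule lattice_inclusion_orderI)
  fix A B :: "'a set" assume "A \<in> {I. two_sided_ideal I}" "B \<in> {I. two_sided_ideal I}"
  then have A: "right_ideal A" "\<And>x r. x \<in> A \<Longrightarrow> r * x \<in> A"
    and B: "right_ideal B" "\<And>x r. x \<in> B \<Longrightarrow> r * x \<in> B"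
    by (simp_all add: two_sided_ideal_iff_right_ideal[OF reg])
  have "two_sided_ideal (A + B)"
    unfolding two_sided_ideal_iff_right_ideal[OF reg]
  proof (intro conjI ballI allI right_ideal_set_plus A(1) B(1))
    fix x r assume "x \<in> A + B"
    then obtain a b where x: "x = a + b" "a \<in> A" "b \<in> B" by (rule set_plus_elim)
    show "r * x \<in> A + B" unfolding x(1) distrib_left by (intro set_plus_intro A(2) B(2) x)
  qed
  then show "\<exists>U\<in>{I. two_sided_ideal I}. A \<subseteq> U \<and> B \<subseteq> U \<and>
      (\<forall>V\<in>{I. two_sided_ideal I}. A \<subseteq> V \<longrightarrow> B \<subseteq> V \<longrightarrow> U \<subseteq> V)"
    using subset_set_plus[OF A(1) B(1)]
    by (intro bexI[of _ "A + B"]) (simp_all add: two_sided_ideal_iff_right_ideal[OF reg] set_plus_subset)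
  have "two_sided_ideal (A \<inter> B)"
    using A B by (simp add: two_sided_ideal_iff_right_ideal[OF reg] right_ideal_Int)
  then show "\<exists>U\<in>{I. two_sided_ideal I}. U \<subseteq> A \<and> U \<subseteq> B \<and>
      (\<forall>V\<in>{I. two_sided_ideal I}. V \<subseteq> A \<longrightarrow> V \<subseteq> B \<longrightarrow> V \<subseteq> U)"
    by (intro bexI[of _ "A \<inter> B"]) simp_all
qed

theorem mainTheorem16:
  assumes regular: "\<forall>a::'a::ring. \<exists>b. a = a * b * a"
  defines "L \<equiv> (principal_right_ideals :: 'a set gorder)"
  shows "lattice_isomorphism (neutral_ideals L) (two_sided_ideals :: 'a set gorder) ring_ideal_of \<and>
    lattice_isomorphism (two_sided_ideals :: 'a set gorder) (neutral_ideals L) neutral_ideal_of \<and>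
    (\<forall>\<I>\<in>carrier (neutral_ideals L). neutral_ideal_of (ring_ideal_of \<I>) = \<I>) \<and>
    (\<forall>I\<in>carrier (two_sided_ideals :: 'a set gorder). ring_ideal_of (neutral_ideal_of I) = I)"
proof -
  have reg: "regular_ring TYPE('a)" using regular by (simp add: regular_ring_def)
  let ?N = "{P. neutral_ideal L P}" and ?T = "{I. two_sided_ideal (I :: 'a set)}"
  have right: "right_ideal I" if "I \<in> ?T" for I
    using that by (simp add: two_sided_ideal_iff_right_ideal[OF reg])
  have inv: "ring_ideal_of (neutral_ideal_of I) = I" if "I \<in> ?T" for I
    using ring_ideal_of_neutral_ideal_of[OF reg right[OF that]] .
  have N: "right_ideal (ring_ideal_of P)" "neutral_ideal_of (ring_ideal_of P) = P" if "P \<in> ?N" for P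
  proof -
    have "lattice_ideal principal_right_ideals P"
      using that by (simp only: L_def neutral_ideal_def mem_Collect_eq)
    then show "right_ideal (ring_ideal_of P)" "neutral_ideal_of (ring_ideal_of P) = P"
      by (rule lattice_ideal_imp_neutral_ideal_of[OF reg])+
  qed
  \<comment> \<open>\<open>P\<close> is the image of the right ideal \<open>ring_ideal_of P\<close>,
    so the neutrality criterion applies to that right ideal.\<close>
  have toT: "ring_ideal_of P \<in> ?T" if "P \<in> ?N" for P
    using N[OF that] that neutral_ideal_neutral_ideal_of_iff[OF reg, of "ring_ideal_of P"]
    by (simp add: L_def)
  have toN: "neutral_ideal_of I \<in> ?N" if "I \<in> ?T" for I
    using that right[OF that] by (simp add: L_def neutral_ideal_neutral_ideal_of_iff[OF reg])
  \<comment> \<open>This direction comes first because its source is already known to be a lattice.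
    It supplies the lattice property of the neutral ideals, from which the inverse map
    starts.\<close>
  have "lattice_isomorphism (inclusion_order ?T) (inclusion_order ?N) neutral_ideal_of"
  proof (rule lattice_isomorphism_inclusion_order)
    show "lattice (inclusion_order ?T)"
      using lattice_two_sided_ideals[OF reg] by (simp add: two_sided_ideals_def)
    show "bij_betw neutral_ideal_of ?T ?N"
      by (rule bij_betw_byWitness[where f' = ring_ideal_of]) (use inv N toT toN in \<open>simp_all add: image_subset_iff\<close>)
  qed (intro neutral_ideal_of_subset_iff[OF reg] right)
  moreover have "lattice_isomorphism (inclusion_order ?N) (inclusion_order ?T) ring_ideal_of"
  proof (rule lattice_isomorphism_inclusion_order)
    show "lattice (inclusion_order ?N)" using calculation by (simp add: lattice_isomorphism_def)
    show "bij_betw ring_ideal_of ?N ?T"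
      by (rule bij_betw_byWitness[where f' = neutral_ideal_of]) (use inv N toT toN in \<open>simp_all add: image_subset_iff\<close>)
    show "ring_ideal_of P \<subseteq> ring_ideal_of Q \<longleftrightarrow> P \<subseteq> Q" if "P \<in> ?N" "Q \<in> ?N" for P Q
      using neutral_ideal_of_subset_iff[OF reg N(1) N(1), OF that] N(2) that by simp
  qed
  ultimately show ?thesis
    using inv N by (simp add: neutral_ideals_def two_sided_ideals_def)
qed

end
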